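(* Let $\mathbf{k}$ be a field of characteristic $0$ and let $(A,\mu,\alpha)$ be a Hom-algebra over $\mathbf{k}$. For $\lambda\in\mathbf{k}$ let $A(\lambda)=(A,\mu_\lambda=\lambda\mu+(1-\lambda)\mu^{op},\alpha)$. Then $A$ is Hom-power associative if and only if $A(\lambda)$ is Hom-power associative for all $\lambda\in\mathbf{k}$.
   Context: A Hom-algebra $(A,\mu,\alpha)$ over $\mathbf{k}$ is a $\mathbf{k}$-vector space $A$ with a bilinear map $\mu\colon A^{\otimes 2}\to A$ (no associativity assumed) and a linear map $\alpha\colon A\to A$. The opposite multiplication is $\mu^{op}(x,y)=\mu(y,x)$. Here $\alpha^n$ is the $n$-fold composition, $\alpha^0=Id$. Hom-powers: $x^1=x$ and $x^n=\mu(x^{n-1},\alpha^{n-2}(x))$ for $n\ge 2$. $A$ is Hom-power associative if $x^n=\mu(\alpha^{n-i-1}(x^i),\alpha^{i-1}(x^{n-i}))$ for all $x\in A$, $n\ge 2$ and $i\in\{1,\dots,n-1\}$. For $A(\lambda)$ these notions are taken with respect to $\mu_\lambda$ and $\alpha$. *)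

theory Defs imports Complex_Main
begin

locale hom_algebra = vector_space scale
  for scale :: "'k::field \<Rightarrow> 'a::ab_group_add \<Rightarrow> 'a" +
  fixes mu :: "'a \<Rightarrow> 'a \<Rightarrow> 'a" and alpha :: "'a \<Rightarrow> 'a"
  assumes linear_mu_left: "\<And>y. Vector_Spaces.linear scale scale (\<lambda>x. mu x y)"
    and linear_mu_right: "\<And>x. Vector_Spaces.linear scale scale (\<lambda>y. mu x y)"
    and linear_alpha: "Vector_Spaces.linear scale scale alpha"

(* The value at exponent 0 is a dummy: Hom-powers are only defined for exponents at least 1. *)
fun hom_power :: "('a::zero \<Rightarrow> 'a \<Rightarrow> 'a) \<Rightarrow> ('a \<Rightarrow> 'a) \<Rightarrow> 'a \<Rightarrow> nat \<Rightarrow> 'a" where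
  "hom_power mu alpha x 0 = 0"
| "hom_power mu alpha x (Suc 0) = x"
| "hom_power mu alpha x (Suc (Suc m)) = mu (hom_power mu alpha x (Suc m)) ((alpha ^^ m) x)"

definition hom_power_associative :: "('a::zero \<Rightarrow> 'a \<Rightarrow> 'a) \<Rightarrow> ('a \<Rightarrow> 'a) \<Rightarrow> bool" where
  "hom_power_associative mu alpha \<longleftrightarrow>
     (\<forall>x. \<forall>n\<ge>2. \<forall>i\<in>{1..n - 1}.
        hom_power mu alpha x n =
          mu ((alpha ^^ (n - i - 1)) (hom_power mu alpha x i))
             ((alpha ^^ (i - 1)) (hom_power mu alpha x (n - i))))"

definition opposite_mult :: "('a \<Rightarrow> 'a \<Rightarrow> 'a) \<Rightarrow> 'a \<Rightarrow> 'a \<Rightarrow> 'a" where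
  "opposite_mult mu x y = mu y x"

definition mutation ::
  "('k::field \<Rightarrow> 'a::ab_group_add \<Rightarrow> 'a) \<Rightarrow> ('a \<Rightarrow> 'a \<Rightarrow> 'a) \<Rightarrow> 'k \<Rightarrow> 'a \<Rightarrow> 'a \<Rightarrow> 'a" where
  "mutation scale mu l x y = scale l (mu x y) + scale (1 - l) (opposite_mult mu x y)"

lemma (in hom_algebra) hom_algebra_mutation:
  "hom_algebra scale (mutation scale mu l) alpha"
proof -
  interpret pair: vector_space_pair scale scale ..
  show ?thesis
    unfolding mutation_def opposite_mult_def
    by (intro hom_algebra.intro vector_space_axioms hom_algebra_axioms.intro
        pair.linear_compose_add pair.linear_compose_scale_right
        linear_mu_left linear_mu_right linear_alpha)
qed

end

theory Submission imports Defs
begin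

text \<open>The defining equation of Hom-power associativity is symmetric under
  \<open>i \<mapsto> n - i\<close>: this exchange turns the product for \<open>\<mu>\<close> into the product for
  the opposite multiplication. Hence, if \<open>A\<close> is Hom-power associative, both \<open>\<mu>\<close> and
  \<open>\<mu>\<^sup>o\<^sup>p\<close> send the pair \<open>(\<alpha>\<^sup>n\<^sup>-\<^sup>i\<^sup>-\<^sup>1(x\<^sup>i), \<alpha>\<^sup>i\<^sup>-\<^sup>1(x\<^sup>n\<^sup>-\<^sup>i))\<close> to \<open>x\<^sup>n\<close>, and so does every
  affine combination \<open>\<lambda>\<mu> + (1 - \<lambda>)\<mu>\<^sup>o\<^sup>p\<close> because its coefficients sum to 1
  (\<open>mutation_of_powers\<close>). By induction the Hom-powers of \<open>A(\<lambda>)\<close> are those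
  of \<open>A\<close> (\<open>hom_power_mutation\<close>), and the same computation gives Hom-power
  associativity of \<open>A(\<lambda>)\<close>. Conversely, \<open>A = A(1)\<close>.\<close>

lemma hom_power_associativeD:
  assumes "hom_power_associative mu alpha" and "1 \<le> i" and "i < n"
  shows "mu ((alpha ^^ (n - i - 1)) (hom_power mu alpha x i))
            ((alpha ^^ (i - 1)) (hom_power mu alpha x (n - i))) = hom_power mu alpha x n"
proof -
  have "2 \<le> n" and "i \<in> {1..n - 1}"
    using assms(2,3) by auto
  then show ?thesis
    using assms(1) unfolding hom_power_associative_def by metis
qed

context hom_algebra
begin

lemma mutation_of_powers:
  assumes "hom_power_associative mu alpha" and "1 \<le> i" and "i < n"
  shows "mutation scale mu l
            ((alpha ^^ (n - i - 1)) (hom_power mu alpha x i))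
            ((alpha ^^ (i - 1)) (hom_power mu alpha x (n - i))) = hom_power mu alpha x n"
proof -
  let ?a = "(alpha ^^ (n - i - 1)) (hom_power mu alpha x i)"
  let ?b = "(alpha ^^ (i - 1)) (hom_power mu alpha x (n - i))"
  have "mu ?a ?b = hom_power mu alpha x n"
    using assms by (rule hom_power_associativeD)
  moreover have "mu ?b ?a = hom_power mu alpha x n"
    using hom_power_associativeD[OF assms(1), of "n - i" n x] assms(2,3) by simp
  ultimately show ?thesis
    by (simp add: mutation_def opposite_mult_def flip: scale_left_distrib)
qed

lemma hom_power_mutation:
  assumes "hom_power_associative mu alpha"
  shows "hom_power (mutation scale mu l) alpha x n = hom_power mu alpha x n"
proof (induction n rule: induct_nat_012)
  case (ge2 m)
  \<comment> \<open>The recursion for Hom-powers is the product with \<open>i = n - 1\<close>.\<close>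
  then show ?case
    using mutation_of_powers[OF assms, of "Suc m" "Suc (Suc m)" l x] by simp
qed simp_all

lemma hom_power_associative_mutation:
  assumes "hom_power_associative mu alpha"
  shows "hom_power_associative (mutation scale mu l) alpha"
  unfolding hom_power_associative_def hom_power_mutation[OF assms]
  by (intro allI impI ballI mutation_of_powers[OF assms, symmetric]) auto

lemma mutation_one: "mutation scale mu 1 = mu"
  by (simp add: mutation_def fun_eq_iff)

end

theorem corollary2p10:
  fixes scale :: "'k::field_char_0 \<Rightarrow> 'a::ab_group_add \<Rightarrow> 'a"
    and mu :: "'a \<Rightarrow> 'a \<Rightarrow> 'a" and alpha :: "'a \<Rightarrow> 'a"
  assumes "hom_algebra scale mu alpha"
  shows "hom_power_associative mu alpha \<longleftrightarrow>
    (\<forall>l::'k. hom_power_associative (mutation scale mu l) alpha)"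
proof -
  interpret hom_algebra scale mu alpha by (fact assms)
  show ?thesis
    using hom_power_associative_mutation mutation_one by metis
qed

end
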